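(* Let $S$ be the usual step-reinforced random walk on $G=(\mathbb{Z}_2,+)$ with reinforcement parameter $\alpha\in(0,1)$ and step distribution $\mu$ given by $\mu(0)=\mu(1)=1/2$. Then for every integer $n\ge1$ one has $\mathbb{P}(S_{2n-1}=0)=1/2$ and $$e^{-(1-\alpha)n}\alpha^n\le 2\mathbb{P}(S_{2n}=0)-1\le\alpha^n.$$ In particular, for every integer $n\ge1$, $$\lim_{\alpha\to0+}\frac{\log(2\mathbb{P}(S_{2n}=0)-1)}{\log\alpha}=n,\qquad\lim_{\alpha\to1-}\frac{\log(1-\mathbb{P}(S_{2n}=0))}{\log(1-\alpha)}=1.$$
   Context: The usual step-reinforced random walk on a discrete abelian group $(G,+)$ with parameter $\alpha$ and step distribution $\mu$: let $(g_n)_{n\ge1}$ be i.i.d. with law $\mu$, $(\xi_n)_{n\ge2}$ i.i.d. Bernoulli with parameter $\alpha$, and $(u_n)_{n\ge2}$ independent with $u_n$ uniform on $\{1,\ldots,n-1\}$, the three sequences being mutually independent. Set $S_0=0$, $X_1=g_1$, and for $n\ge2$ set $X_n=g_n$ if $\xi_n=0$ and $X_n=X_{u_n}$ if $\xi_n=1$. Put $S_n=X_1+\cdots+X_n$. *)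

theory Defs
  imports "HOL-Probability.Probability" "HOL-Library.Z2"
begin

definition process_events ::
  "'w measure \<Rightarrow> (nat \<Rightarrow> 'b measure) \<Rightarrow> (nat \<Rightarrow> 'w \<Rightarrow> 'b) \<Rightarrow> nat set \<Rightarrow> 'w set set" where
  "process_events M N Y I =
     sigma_sets (space M) (\<Union>i\<in>I. {Y i -` A \<inter> space M | A. A \<in> sets (N i)})"

text \<open>The reinforcement indicator is Boolean-valued, with \<^const>\<open>True\<close> for the value 1, to match
  \<^const>\<open>bernoulli_pmf\<close>. Each \<open>u n\<close> takes values in \<open>{1..<n}\<close> everywhere on the sample space, not
  only almost surely, because it is measurable into \<open>count_space {1..<n}\<close>.\<close>

locale step_reinforced = prob_space M
  for M :: "'w measure" +
  fixes \<alpha> :: real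
    and \<mu> :: "'a::ab_group_add pmf"
    and g :: "nat \<Rightarrow> 'w \<Rightarrow> 'a"
    and \<xi> :: "nat \<Rightarrow> 'w \<Rightarrow> bool"
    and u :: "nat \<Rightarrow> 'w \<Rightarrow> nat"
  assumes param: "0 \<le> \<alpha>" "\<alpha> \<le> 1"
    and g_indep: "indep_vars (\<lambda>_. count_space UNIV) g {1..}"
    and g_law: "\<And>n. n \<ge> 1 \<Longrightarrow> distr M (count_space UNIV) (g n) = measure_pmf \<mu>"
    and \<xi>_indep: "indep_vars (\<lambda>_. count_space UNIV) \<xi> {2..}"
    and \<xi>_law: "\<And>n. n \<ge> 2 \<Longrightarrow> distr M (count_space UNIV) (\<xi> n) = measure_pmf (bernoulli_pmf \<alpha>)"
    and u_indep: "indep_vars (\<lambda>n. count_space {1..<n}) u {2..}"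
    and u_law: "\<And>n. n \<ge> 2 \<Longrightarrow> distr M (count_space {1..<n}) (u n) = uniform_count_measure {1..<n}"
    and sequences_indep: "indep_sets
      ((!) [process_events M (\<lambda>_. count_space UNIV) g {1..},
            process_events M (\<lambda>_. count_space UNIV) \<xi> {2..},
            process_events M (\<lambda>n. count_space {1..<n}) u {2..}]) {..<3}"

text \<open>The guard \<open>u n w < n\<close> only serves termination: it always holds for \<open>n \<ge> 2\<close> and
  \<open>w \<in> space M\<close> in the locale above.\<close>

fun reinforced_step ::
  "(nat \<Rightarrow> 'w \<Rightarrow> 'a) \<Rightarrow> (nat \<Rightarrow> 'w \<Rightarrow> bool) \<Rightarrow> (nat \<Rightarrow> 'w \<Rightarrow> nat) \<Rightarrow> nat \<Rightarrow> 'w \<Rightarrow> 'a" where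
  "reinforced_step g \<xi> u n w =
     (if n \<ge> 2 \<and> \<xi> n w \<and> u n w < n then reinforced_step g \<xi> u (u n w) w else g n w)"

declare reinforced_step.simps [simp del]

definition reinforced_walk ::
  "(nat \<Rightarrow> 'w \<Rightarrow> 'a::ab_group_add) \<Rightarrow> (nat \<Rightarrow> 'w \<Rightarrow> bool) \<Rightarrow> (nat \<Rightarrow> 'w \<Rightarrow> nat)
     \<Rightarrow> nat \<Rightarrow> 'w \<Rightarrow> 'a" where
  "reinforced_walk g \<xi> u n w = (\<Sum>k=1..n. reinforced_step g \<xi> u k w)"

end

theory Submission
  imports Defs "HOL-Computational_Algebra.Polynomial" "HOL-Real_Asymp.Real_Asymp"
begin

text \<open>
  Why the theorem holds. In \<^typ>\<open>bit\<close> the walk vanishes exactly when the number \<open>K\<^sub>k\<close> of ones among the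
  first \<open>k\<close> steps is even, so \<open>2 * P(S\<^sub>k = 0) - 1\<close> is the expected sign \<open>E ((-1)^K\<^sub>k)\<close>. The counts form a
  Markov chain, a Friedman urn: given the past, step \<open>k + 1\<close> is a one with probability
  \<open>(1 - \<alpha>) / 2 + \<alpha> * K\<^sub>k / k\<close>. The expected signs alone satisfy no closed recursion, but the functions
  \<open>H\<^sub>k(x) = E ((-1)^K\<^sub>k * exp (x * (k - 2 * K\<^sub>k)))\<close> do:

  \<open>H\<^sub>1 = sinh\<close> and \<open>H\<^sub>k\<^sub>+\<^sub>1 = sinh * H\<^sub>k + (\<alpha> / k) * cosh * H\<^sub>k'\<close>.

  In the variable \<open>s = sinh x\<close> this says \<open>H\<^sub>k(x) = q\<^sub>k(sinh x)\<close> for polynomials with \<open>q\<^sub>1 = s\<close> and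
  \<open>q\<^sub>k\<^sub>+\<^sub>1 = s * q\<^sub>k + (\<alpha> / k) * (1 + s^2) * q\<^sub>k'\<close>, and the expected sign is \<open>q\<^sub>k(0)\<close>. The power \<open>s^j\<close>
  occurs in \<open>q\<^sub>k\<close> only if \<open>k - j\<close> is even, which gives \<open>P(S\<^sub>k = 0) = 1/2\<close> for odd \<open>k\<close>.

  The two inequalities come from comparison with \<open>\<alpha> = 1\<close>, where all steps coincide and
  \<open>q\<^sub>k(sinh x)\<close> equals \<open>cosh (k * x)\<close> or \<open>sinh (k * x)\<close> according to the parity of \<open>k\<close>; in particular
  \<open>q\<^sub>2\<^sub>n(0) = 1\<close>. The recursion for the coefficients has nonnegative weights and can be compared term by
  term: the coefficient of \<open>s^j\<close> in \<open>q\<^sub>k\<close>, with \<open>k = j + 2 * i\<close>, is at most \<open>\<alpha>^i\<close> times and at least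
  \<open>\<alpha>^i * \<delta>^(i + j - 1)\<close> times its value for \<open>\<alpha> = 1\<close>, where \<open>\<delta> = (1 + \<alpha>) / 2\<close>
  (\<open>coeff_fourier_poly_bounds\<close>). With \<open>j = 0\<close> and \<open>i = n\<close>, the bound \<open>exp (- (1 - \<alpha>)) \<le> \<delta> \<le> 1\<close>
  finishes the estimate. Both limits follow by squeezing.

  The probabilistic input is \<open>prob_next_step\<close>, the conditional law of the next step. It rests on the
  independence of the innovations at time \<open>k + 1\<close> from all events determined by the earlier ones; as the
  group is finite, such an event is a finite disjoint union of cylinders.
\<close>

section \<open>The polynomials of the expected sign\<close>

text \<open>The polynomials \<open>q\<^sub>k\<close> of the introduction. The recursion may start at \<open>0\<close>: the derivative of \<open>1\<close>
  vanishes, so the division by \<open>k = 0\<close> has no effect and \<open>q\<^sub>1 = s\<close>.\<close>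

fun fourier_poly :: "real \<Rightarrow> nat \<Rightarrow> real poly" where
  "fourier_poly \<alpha> 0 = 1"
| "fourier_poly \<alpha> (Suc k) = [:0, 1:] * fourier_poly \<alpha> k +
     smult (\<alpha> / k) ([:1, 0, 1:] * pderiv (fourier_poly \<alpha> k))"

text \<open>The substitution \<open>s = sinh x\<close> works because the derivative of \<open>q (sinh x)\<close>, multiplied by \<open>cosh x\<close>, is
  \<open>(cosh x)^2 * q' (sinh x)\<close>, and \<open>(cosh x)^2 = 1 + s^2\<close>. Stated for arbitrary solutions of the recursion,
  the lemma serves both the walk and the explicit comparison solution.\<close>

lemma poly_fourier_poly_sinh:
  fixes H H' :: "nat \<Rightarrow> real \<Rightarrow> real"
  assumes one: "\<And>x. H 1 x = sinh x"
    and Suc: "\<And>k x. k \<ge> 1 \<Longrightarrow> H (Suc k) x = sinh x * H k x + \<alpha> / k * (cosh x * H' k x)"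
    and deriv: "\<And>k x. k \<ge> 1 \<Longrightarrow> (H k has_real_derivative H' k x) (at x)"
    and "k \<ge> 1"
  shows "H k x = poly (fourier_poly \<alpha> k) (sinh x)"
  using \<open>k \<ge> 1\<close>
proof (induction k arbitrary: x rule: nat_induct_at_least)
  case base
  show ?case using one[of x] by (simp add: pderiv_1)
next
  case (Suc k)
  let ?q = "fourier_poly \<alpha> k"
  have "((\<lambda>x. poly ?q (sinh x)) has_real_derivative poly (pderiv ?q) (sinh x) * cosh x) (at x)"
    by (auto intro!: derivative_eq_intros poly_DERIV[THEN DERIV_chain2])
  moreover have "H k = (\<lambda>x. poly ?q (sinh x))"
    using Suc.IH by auto
  ultimately have "H' k x = poly (pderiv ?q) (sinh x) * cosh x"
    using deriv[OF Suc.hyps] DERIV_unique by metis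
  moreover have "cosh x * cosh x = 1 + sinh x * sinh x"
    using cosh_square_eq[of x] by (simp add: power2_eq_square)
  ultimately have "cosh x * H' k x = (1 + sinh x * sinh x) * poly (pderiv ?q) (sinh x)"
    by (metis mult.assoc mult.commute)
  then show ?case
    using assms(2)[OF Suc.hyps, of x] Suc.IH[of x] by (simp add: algebra_simps)
qed

text \<open>For \<open>\<alpha> = 1\<close> all steps coincide, so the number of ones is \<open>0\<close> or \<open>k\<close> with equal probability, whence
  the two exponentials.\<close>

lemma poly_fourier_poly_1_sinh:
  assumes "k \<ge> 1"
  shows "poly (fourier_poly 1 k) (sinh x) = (exp (k * x) + (-1) ^ k * exp (- (k * x))) / 2"
proof -
  define H :: "nat \<Rightarrow> real \<Rightarrow> real"
    where "H = (\<lambda>k x. (exp (k * x) + (-1) ^ k * exp (- (k * x))) / 2)"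
  define H' :: "nat \<Rightarrow> real \<Rightarrow> real"
    where "H' = (\<lambda>k x. k * (exp (k * x) - (-1) ^ k * exp (- (k * x))) / 2)"
  have "H k x = poly (fourier_poly 1 k) (sinh x)"
  proof (rule poly_fourier_poly_sinh[where H = H and H' = H'])
    show "H 1 x = sinh x" for x
      by (simp add: H_def sinh_field_def)
    show "(H k has_real_derivative H' k x) (at x)" for k x
      unfolding H_def H'_def by (auto intro!: derivative_eq_intros simp: field_simps)
    show "H (Suc k) x = sinh x * H k x + 1 / k * (cosh x * H' k x)" if "k \<ge> 1" for k x
    proof -
      have "1 / k * (cosh x * H' k x) = cosh x * ((exp (k * x) - (-1) ^ k * exp (- (k * x))) / 2)"
        using that by (simp add: H'_def)
      moreover have "exp (Suc k * x) = exp x * exp (k * x)" "exp (- (Suc k * x)) = exp (- x) * exp (- (k * x))"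
        by (simp_all add: exp_add[symmetric] algebra_simps)
      ultimately show ?thesis
        unfolding H_def by (simp add: sinh_field_def cosh_field_def) (simp add: field_simps)
    qed
  qed fact
  then show ?thesis by (simp add: H_def)
qed

lemma fourier_poly_1_at_0:
  assumes "n \<ge> 1"
  shows "coeff (fourier_poly 1 (2 * n)) 0 = 1"
  using poly_fourier_poly_1_sinh[of "2 * n" 0] assms by (simp add: poly_0_coeff_0)

text \<open>All weights are nonnegative for \<open>\<alpha> \<ge> 0\<close>. This is what the choice of the variable \<open>sinh x\<close> achieves;
  with characteristic functions and \<open>cos x\<close> in its place the signs would alternate.\<close>

lemma coeff_fourier_poly_Suc:
  assumes "k \<ge> 1"
  shows "coeff (fourier_poly \<alpha> (Suc k)) j =
    (if j = 0 then 0 else (1 + \<alpha> * real (j - 1) / k) * coeff (fourier_poly \<alpha> k) (j - 1)) +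
    \<alpha> / k * (real (Suc j) * coeff (fourier_poly \<alpha> k) (Suc j))"
proof -
  have x2: "[:1, 0, 1:] * p = p + pCons 0 (pCons 0 p)" for p :: "real poly"
    by simp
  show ?thesis
  proof (cases j)
    case 0
    then show ?thesis by (simp add: x2 coeff_pderiv del: mult_pCons_left) simp
  next
    case (Suc i)
    show ?thesis
      unfolding fourier_poly.simps x2
      using Suc by (cases i) (simp_all add: coeff_pderiv algebra_simps add_divide_distrib)
  qed
qed

lemma fourier_poly_one [simp]: "fourier_poly \<alpha> (Suc 0) = [:0, 1:]"
  by (simp add: pderiv_1)

declare fourier_poly.simps(2) [simp del]

lemma coeff_fourier_poly_nonzero:
  assumes "k \<ge> 1" "coeff (fourier_poly \<alpha> k) j \<noteq> 0"
  shows "\<exists>i. j + 2 * i = k"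
  using assms
proof (induction k arbitrary: j rule: nat_induct_at_least)
  case base
  then show ?case by (auto simp: coeff_pCons split: nat.splits intro!: exI[of _ 0])
next
  case (Suc k)
  have "j > 0 \<and> coeff (fourier_poly \<alpha> k) (j - 1) \<noteq> 0 \<or> coeff (fourier_poly \<alpha> k) (Suc j) \<noteq> 0"
  proof (rule ccontr)
    assume "\<not> ?thesis"
    then have "coeff (fourier_poly \<alpha> (Suc k)) j = 0"
      unfolding coeff_fourier_poly_Suc[OF Suc.hyps] by auto
    with Suc.prems show False by simp
  qed
  then consider "j > 0" "coeff (fourier_poly \<alpha> k) (j - 1) \<noteq> 0" | "coeff (fourier_poly \<alpha> k) (Suc j) \<noteq> 0"
    by blast
  then show ?case
  proof cases
    case 1
    then show ?thesis using Suc.IH[of "j - 1"] by auto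
  next
    case 2
    then obtain i where "Suc j + 2 * i = k" using Suc.IH by blast
    then have "j + 2 * Suc i = Suc k" by simp
    then show ?thesis by blast
  qed
qed

text \<open>Term-by-term comparison with \<open>\<alpha> = 1\<close>. Each drop of the degree brings a factor \<open>\<alpha>\<close>, and these make up
  \<open>\<alpha>^i\<close>. Raising the degree from \<open>j - 1\<close> to \<open>j\<close> has weight \<open>1 + \<alpha> * y\<close> against \<open>1 + y\<close>, where
  \<open>y = (j - 1) / k \<le> 1\<close>; the ratio is at most \<open>1\<close> and smallest at \<open>y = 1\<close>, where it is \<open>\<delta>\<close>. The lower
  bound is multiplied by \<open>\<delta>\<close> so as to avoid the exponent \<open>i + j - 1\<close> on natural numbers.\<close>

lemma coeff_fourier_poly_bounds:
  fixes \<alpha> :: real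
  defines "\<delta> \<equiv> (1 + \<alpha>) / 2"
  assumes \<alpha>: "0 \<le> \<alpha>" "\<alpha> \<le> 1" and "k \<ge> 1" "j + 2 * i = k"
  shows "0 \<le> coeff (fourier_poly 1 k) j"
    and "\<alpha> ^ i * \<delta> ^ (i + j) * coeff (fourier_poly 1 k) j \<le> \<delta> * coeff (fourier_poly \<alpha> k) j"
    and "coeff (fourier_poly \<alpha> k) j \<le> \<alpha> ^ i * coeff (fourier_poly 1 k) j"
proof -
  let ?b = "\<lambda>k j. coeff (fourier_poly \<alpha> k) j" and ?t = "\<lambda>k j. coeff (fourier_poly 1 k) j"
  have \<delta>: "0 \<le> \<delta>" "\<delta> \<le> 1" using \<alpha> by (auto simp: \<delta>_def)
  have "0 \<le> ?t k j \<and> \<alpha> ^ i * \<delta> ^ (i + j) * ?t k j \<le> \<delta> * ?b k j \<and> ?b k j \<le> \<alpha> ^ i * ?t k j"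
    using \<open>k \<ge> 1\<close> \<open>j + 2 * i = k\<close>
  proof (induction k arbitrary: j i rule: nat_induct_at_least)
    case base
    then have "i = 0" "j = 1" by presburger+
    then show ?case using \<delta> by simp
  next
    case (Suc k)
    have k: "real k > 0" using Suc.hyps by simp
    \<comment> \<open>Index 1 marks the contribution of the coefficient of degree \<open>j - 1\<close> (same \<open>i\<close>), index 2 that of
      degree \<open>j + 1\<close> (with \<open>i - 1\<close> in place of \<open>i\<close>).\<close>
    define T1 where "T1 = (if j = 0 then 0 else (1 + real (j - 1) / k) * ?t k (j - 1))"
    define B1 where "B1 = (if j = 0 then 0 else (1 + \<alpha> * real (j - 1) / k) * ?b k (j - 1))"
    define T2 where "T2 = 1 / k * (real (Suc j) * ?t k (Suc j))"
    define B2 where "B2 = \<alpha> / k * (real (Suc j) * ?b k (Suc j))"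
    have t: "?t (Suc k) j = T1 + T2" and b: "?b (Suc k) j = B1 + B2"
      using coeff_fourier_poly_Suc[OF Suc.hyps, of 1 j] coeff_fourier_poly_Suc[OF Suc.hyps, of \<alpha> j]
      by (auto simp: T1_def T2_def B1_def B2_def)
    have 1: "0 \<le> T1 \<and> \<alpha> ^ i * \<delta> ^ (i + j) * T1 \<le> \<delta> * B1 \<and> B1 \<le> \<alpha> ^ i * T1"
    proof (cases "j = 0")
      case True
      then show ?thesis by (simp add: T1_def B1_def)
    next
      case False
      define y where "y = real (j - 1) / k"
      have y: "0 \<le> y" "y \<le> 1" using k Suc.prems by (auto simp: y_def)
      have IH: "0 \<le> ?t k (j - 1)" "\<alpha> ^ i * \<delta> ^ (i + (j - 1)) * ?t k (j - 1) \<le> \<delta> * ?b k (j - 1)"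
          "?b k (j - 1) \<le> \<alpha> ^ i * ?t k (j - 1)"
        using Suc.IH[of "j - 1" i] Suc.prems False by auto
      have "(1 + \<alpha> * y) - \<delta> * (1 + y) = (1 - \<alpha>) * (1 - y) / 2"
        by (simp add: \<delta>_def field_simps)
      then have low: "\<delta> * (1 + y) \<le> 1 + \<alpha> * y"
        using y \<alpha> by (smt (verit) divide_nonneg_nonneg mult_nonneg_nonneg)
      have up: "1 + \<alpha> * y \<le> 1 + y" "0 \<le> 1 + \<alpha> * y"
        using y \<alpha> by (auto intro: mult_left_le_one_le)
      have T1: "T1 = (1 + y) * ?t k (j - 1)" and B1: "B1 = (1 + \<alpha> * y) * ?b k (j - 1)"
        using False by (auto simp: T1_def B1_def y_def)
      have pow: "\<delta> ^ (i + j) = \<delta> * \<delta> ^ (i + (j - 1))"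
        using False by (cases j) auto
      have "\<alpha> ^ i * \<delta> ^ (i + j) * T1 = \<delta> * (1 + y) * (\<alpha> ^ i * \<delta> ^ (i + (j - 1)) * ?t k (j - 1))"
        by (simp add: T1 pow)
      also have "\<dots> \<le> (1 + \<alpha> * y) * (\<alpha> ^ i * \<delta> ^ (i + (j - 1)) * ?t k (j - 1))"
        using low IH(1) \<alpha> \<delta> by (intro mult_right_mono) auto
      also have "\<dots> \<le> (1 + \<alpha> * y) * (\<delta> * ?b k (j - 1))"
        using IH(2) up by (intro mult_left_mono) auto
      finally have "\<alpha> ^ i * \<delta> ^ (i + j) * T1 \<le> \<delta> * B1"
        by (simp add: B1 mult_ac)
      moreover have "B1 \<le> (1 + \<alpha> * y) * (\<alpha> ^ i * ?t k (j - 1))"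
        unfolding B1 using IH(3) up by (intro mult_left_mono) auto
      then have "B1 \<le> (1 + y) * (\<alpha> ^ i * ?t k (j - 1))"
        using mult_right_mono[OF up(1), of "\<alpha> ^ i * ?t k (j - 1)"] IH(1) \<alpha> by simp
      ultimately show ?thesis
        using IH(1) y by (simp add: T1 mult_ac)
    qed
    have 2: "0 \<le> T2 \<and> \<alpha> ^ i * \<delta> ^ (i + j) * T2 \<le> \<delta> * B2 \<and> B2 \<le> \<alpha> ^ i * T2"
    proof (cases i)
      case 0
      then have "Suc j > k" using Suc.prems by simp
      then have "?t k (Suc j) = 0" "?b k (Suc j) = 0"
        using coeff_fourier_poly_nonzero[OF Suc.hyps] by (metis le_add1 not_le)+
      then show ?thesis by (simp add: T2_def B2_def)
    next
      case i: (Suc i')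
      then have IH: "0 \<le> ?t k (Suc j)" "\<alpha> ^ i' * \<delta> ^ (i' + Suc j) * ?t k (Suc j) \<le> \<delta> * ?b k (Suc j)"
          "?b k (Suc j) \<le> \<alpha> ^ i' * ?t k (Suc j)"
        using Suc.IH[of "Suc j" i'] Suc.prems by auto
      define c where "c = real (Suc j) / k"
      have c: "0 \<le> c" by (simp add: c_def)
      have T2: "T2 = c * ?t k (Suc j)" and B2: "B2 = c * (\<alpha> * ?b k (Suc j))"
        by (auto simp: T2_def B2_def c_def)
      have "\<alpha> ^ i * \<delta> ^ (i + j) * T2 = c * (\<alpha> * (\<alpha> ^ i' * \<delta> ^ (i' + Suc j) * ?t k (Suc j)))"
        by (simp add: T2 i)
      also have "\<dots> \<le> c * (\<alpha> * (\<delta> * ?b k (Suc j)))"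
        using IH c \<alpha> by (intro mult_left_mono) auto
      finally have "\<alpha> ^ i * \<delta> ^ (i + j) * T2 \<le> \<delta> * B2"
        by (simp add: B2 mult_ac)
      moreover have "B2 \<le> c * (\<alpha> * (\<alpha> ^ i' * ?t k (Suc j)))"
        unfolding B2 using IH c \<alpha> by (intro mult_left_mono) auto
      ultimately show ?thesis
        using IH c by (simp add: T2 i mult_ac)
    qed
    from 1 2 show ?case
      by (auto simp: t b algebra_simps)
  qed
  then show "0 \<le> ?t k j" "\<alpha> ^ i * \<delta> ^ (i + j) * ?t k j \<le> \<delta> * ?b k j" "?b k j \<le> \<alpha> ^ i * ?t k j"
    by auto
qed

lemma exp_minus_le:
  assumes "0 \<le> (\<alpha>::real)" "\<alpha> \<le> 1"
  shows "exp (- (1 - \<alpha>)) \<le> (1 + \<alpha>) / 2"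
proof -
  define b where "b = 1 - \<alpha>"
  have b: "0 \<le> b" "b \<le> 1" using assms by (auto simp: b_def)
  \<comment> \<open>The quadratic Taylor bound suffices: \<open>(1 - b/2) * (1 + b + b^2/2) = 1 + b/2 - b^3/4 \<ge> 1\<close>.\<close>
  have "b * (b * b) \<le> b * 1"
    using b mult_le_one[of b b] by (intro mult_left_mono) auto
  moreover have "(1 - b / 2) * (1 + b + b\<^sup>2 / 2) = 1 + b / 2 - b * (b * b) / 4"
    by (simp add: power2_eq_square field_simps)
  ultimately have "1 \<le> (1 - b / 2) * (1 + b + b\<^sup>2 / 2)"
    using b by linarith
  also have "\<dots> \<le> (1 - b / 2) * exp b"
    using b exp_lower_Taylor_quadratic[of b] by (intro mult_left_mono) auto
  finally have "exp (- b) \<le> 1 - b / 2"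
    by (simp add: exp_minus field_simps)
  then show ?thesis
    by (simp add: b_def field_simps)
qed

lemma fourier_poly_odd_at_0:
  assumes "odd k"
  shows "poly (fourier_poly \<alpha> k) 0 = 0"
proof (rule ccontr)
  assume "poly (fourier_poly \<alpha> k) 0 \<noteq> 0"
  moreover have "k \<ge> 1" using assms odd_pos by force
  ultimately obtain i where "0 + 2 * i = k"
    using coeff_fourier_poly_nonzero[of k \<alpha> 0] by (auto simp: poly_0_coeff_0)
  with assms show False by auto
qed

lemma fourier_poly_even_at_0:
  assumes \<alpha>: "0 \<le> \<alpha>" "\<alpha> \<le> 1" and n: "n \<ge> 1"
  shows "exp (- ((1 - \<alpha>) * real n)) * \<alpha> ^ n \<le> poly (fourier_poly \<alpha> (2 * n)) 0"
    and "poly (fourier_poly \<alpha> (2 * n)) 0 \<le> \<alpha> ^ n"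
proof -
  let ?a = "poly (fourier_poly \<alpha> (2 * n)) 0"
  define \<delta> where "\<delta> = (1 + \<alpha>) / 2"
  have \<delta>: "0 < \<delta>" "\<delta> \<le> 1" using \<alpha> by (auto simp: \<delta>_def)
  have "1 \<le> 2 * n" using n by simp
  note bounds = coeff_fourier_poly_bounds[OF \<alpha> this, of 0 n, folded \<delta>_def]
  show "?a \<le> \<alpha> ^ n"
    using bounds(3) fourier_poly_1_at_0[OF n] by (simp add: poly_0_coeff_0)
  have "\<alpha> ^ n * \<delta> ^ n \<le> \<delta> * ?a"
    using bounds(2) fourier_poly_1_at_0[OF n] by (simp add: poly_0_coeff_0)
  moreover have "0 \<le> ?a"
    using calculation \<delta> \<alpha> by (smt (verit) mult_nonneg_nonneg zero_le_power zero_le_mult_iff)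
  then have "\<delta> * ?a \<le> ?a" using \<delta> by (simp add: mult_left_le_one_le)
  ultimately have "\<alpha> ^ n * \<delta> ^ n \<le> ?a" by linarith
  moreover have "exp (- ((1 - \<alpha>) * real n)) = exp (- (1 - \<alpha>)) ^ n"
    by (simp add: exp_of_nat_mult[symmetric] algebra_simps)
  moreover have "exp (- (1 - \<alpha>)) ^ n \<le> \<delta> ^ n"
    unfolding \<delta>_def using exp_minus_le[OF \<alpha>] by (intro power_mono) auto
  ultimately show "exp (- ((1 - \<alpha>) * real n)) * \<alpha> ^ n \<le> ?a"
    using \<alpha> mult_right_mono[of "exp (- (1 - \<alpha>)) ^ n" "\<delta> ^ n" "\<alpha> ^ n"] by (simp add: mult_ac)
qed

section \<open>Independence of the next innovation from the past\<close>

lemma cylinder_in_process_events: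
  assumes "finite J" "J \<subseteq> I" "\<And>j. j \<in> J \<Longrightarrow> A j \<in> sets (N j)"
  shows "{w \<in> space M. \<forall>j\<in>J. Y j w \<in> A j} \<in> process_events M N Y I"
proof -
  define gens where "gens = (\<Union>i\<in>I. {Y i -` A \<inter> space M | A. A \<in> sets (N i)})"
  have gens: "gens \<subseteq> Pow (space M)"
    by (auto simp: gens_def)
  have "{w \<in> space (sigma (space M) gens). \<forall>j\<in>J. Y j w \<in> A j} \<in> sets (sigma (space M) gens)"
  proof (rule sets.sets_Collect_finite_All)
    fix j assume "j \<in> J"
    then have "Y j -` A j \<inter> space M \<in> gens"
      using assms by (auto simp: gens_def)
    moreover have "{w \<in> space (sigma (space M) gens). Y j w \<in> A j} = Y j -` A j \<inter> space M"
      using gens by (auto simp: space_measure_of)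
    ultimately show "{w \<in> space (sigma (space M) gens). Y j w \<in> A j} \<in> sets (sigma (space M) gens)"
      using gens by (auto simp: sets_measure_of)
  qed (fact assms)
  then show ?thesis
    using gens by (simp add: process_events_def gens_def sets_measure_of space_measure_of)
qed

lemma (in prob_space) indep_vars_split_off_one:
  assumes indep: "indep_vars N Y I"
    and J: "finite J" "J \<subseteq> I" "i \<in> I" "i \<notin> J"
    and A: "\<And>j. j \<in> J \<Longrightarrow> A j \<in> sets (N j)" and B: "B \<in> sets (N i)"
  shows "prob {w \<in> space M. (\<forall>j\<in>J. Y j w \<in> A j) \<and> Y i w \<in> B} =
         prob {w \<in> space M. \<forall>j\<in>J. Y j w \<in> A j} * prob {w \<in> space M. Y i w \<in> B}"
proof (cases "J = {}")
  case True
  then show ?thesis by (simp add: prob_space)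
next
  case False
  define A' where "A' = A(i := B)"
  have A': "A' i = B" "\<And>j. j \<in> J \<Longrightarrow> A' j = A j"
    using J by (auto simp: A'_def)
  have "prob (\<Inter>j\<in>insert i J. Y j -` A' j \<inter> space M) =
      (\<Prod>j\<in>insert i J. prob (Y j -` A' j \<inter> space M))"
    using J A B A' by (intro indep_varsD[OF indep]) auto
  also have "\<dots> = (\<Prod>j\<in>J. prob (Y j -` A j \<inter> space M)) * prob (Y i -` B \<inter> space M)"
    using J A' by simp
  also have "(\<Prod>j\<in>J. prob (Y j -` A j \<inter> space M)) = prob (\<Inter>j\<in>J. Y j -` A j \<inter> space M)"
    using J A False by (intro indep_varsD[OF indep, symmetric]) auto
  also have "(\<Inter>j\<in>J. Y j -` A j \<inter> space M) = {w \<in> space M. \<forall>j\<in>J. Y j w \<in> A j}"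
    using False by auto
  also have "(\<Inter>j\<in>insert i J. Y j -` A' j \<inter> space M) =
      {w \<in> space M. (\<forall>j\<in>J. Y j w \<in> A j) \<and> Y i w \<in> B}"
    using A' by auto
  also have "Y i -` B \<inter> space M = {w \<in> space M. Y i w \<in> B}"
    by auto
  finally show ?thesis .
qed

lemma restrict_eq_restrict_iff:
  "restrict f A = restrict f' A \<longleftrightarrow> (\<forall>x\<in>A. f x = f' x)"
  by (auto simp: restrict_def fun_eq_iff)

locale finite_step_reinforced = step_reinforced M \<alpha> \<mu> g \<xi> u
  for M :: "'w measure" and \<alpha> :: real and \<mu> :: "'a::ab_group_add pmf" and g \<xi> u +
  assumes finite_group: "finite (UNIV :: 'a set)"
begin

lemma measurable_g: "j \<ge> 1 \<Longrightarrow> g j \<in> measurable M (count_space UNIV)"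
  using g_indep by (simp add: indep_vars_def)

lemma measurable_\<xi>: "j \<ge> 2 \<Longrightarrow> \<xi> j \<in> measurable M (count_space UNIV)"
  using \<xi>_indep by (simp add: indep_vars_def)

lemma measurable_u: "j \<ge> 2 \<Longrightarrow> u j \<in> measurable M (count_space {1..<j})"
  using u_indep by (simp add: indep_vars_def)

lemma u_range: "j \<ge> 2 \<Longrightarrow> w \<in> space M \<Longrightarrow> u j w \<in> {1..<j}"
  using measurable_space[OF measurable_u] by simp

lemma prob_g: "j \<ge> 1 \<Longrightarrow> prob {w \<in> space M. g j w = x} = pmf \<mu> x"
  using measure_distr[OF measurable_g, of j "{x}"] g_law[of j]
  by (simp add: vimage_def Int_def conj_commute measure_pmf_single)

lemma prob_\<xi>: "j \<ge> 2 \<Longrightarrow> prob {w \<in> space M. \<xi> j w = b} = (if b then \<alpha> else 1 - \<alpha>)"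
  using measure_distr[OF measurable_\<xi>, of j "{b}"] \<xi>_law[of j] param
  by (cases b) (simp_all add: vimage_def Int_def conj_commute measure_pmf_single)

lemma prob_u:
  assumes "j \<ge> 2" "l \<in> {1..<j}"
  shows "prob {w \<in> space M. u j w = l} = 1 / real (j - 1)"
proof -
  have "prob {w \<in> space M. u j w = l} = measure (distr M (count_space {1..<j}) (u j)) {l}"
    using assms measure_distr[OF measurable_u, of j "{l}"]
    by (simp add: vimage_def Int_def conj_commute)
  also have "\<dots> = 1 / real (j - 1)"
    using assms by (subst u_law) (auto simp: measure_uniform_count_measure)
  finally show ?thesis .
qed

lemma prob_three_sequences:
  assumes "A \<in> process_events M (\<lambda>_. count_space UNIV) g {1..}"
    and "B \<in> process_events M (\<lambda>_. count_space UNIV) \<xi> {2..}"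
    and "C \<in> process_events M (\<lambda>n. count_space {1..<n}) u {2..}"
  shows "prob (A \<inter> B \<inter> C) = prob A * prob B * prob C"
proof -
  have three: "{..<3} = {0, 1, 2::nat}" by auto
  have "prob (\<Inter>j\<in>{..<3}. [A, B, C] ! j) = (\<Prod>j\<in>{..<3}. prob ([A, B, C] ! j))"
    using assms by (intro indep_setsD[OF sequences_indep]) (auto simp: three)
  then show ?thesis
    by (simp add: three Int_assoc mult.assoc)
qed

text \<open>The innovations that determine the first \<open>k\<close> steps. Reinforcement starts at time \<open>2\<close>; the model says
  nothing about \<open>\<xi> 1\<close> and \<open>u 1\<close>, which may even fail to be measurable and must stay out.\<close>

definition history :: "nat \<Rightarrow> 'w \<Rightarrow> (nat \<Rightarrow> 'a) \<times> (nat \<Rightarrow> bool) \<times> (nat \<Rightarrow> nat)" where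
  "history k w = (restrict (\<lambda>j. g j w) {1..k}, restrict (\<lambda>j. \<xi> j w) {2..k},
     restrict (\<lambda>j. u j w) {2..k})"

lemma history_eq_iff:
  "history k w = history k w' \<longleftrightarrow>
     (\<forall>j\<in>{1..k}. g j w = g j w') \<and> (\<forall>j\<in>{2..k}. \<xi> j w = \<xi> j w') \<and> (\<forall>j\<in>{2..k}. u j w = u j w')"
  by (simp add: history_def restrict_eq_restrict_iff)

lemma finite_history: "finite (history k ` space M)"
proof (rule finite_subset)
  show "history k ` space M \<subseteq> PiE {1..k} (\<lambda>_. UNIV) \<times> PiE {2..k} (\<lambda>_. UNIV) \<times> PiE {2..k} (\<lambda>j. {1..<j})"
    using u_range by (auto simp: history_def)
qed (intro finite_cartesian_product finite_PiE; simp add: finite_group)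

lemma reinforced_step_history:
  assumes "1 \<le> l" "l \<le> k" "w \<in> space M" "w' \<in> space M" "history k w = history k w'"
  shows "reinforced_step g \<xi> u l w = reinforced_step g \<xi> u l w'"
  using assms(1,2)
proof (induction l rule: less_induct)
  case (less l)
  show ?case
  proof (cases "l \<ge> 2 \<and> \<xi> l w \<and> u l w < l")
    case True
    then have "\<xi> l w' = \<xi> l w" "u l w' = u l w" "1 \<le> u l w"
      using assms less.prems u_range[of l w] by (auto simp: history_eq_iff)
    with True less show ?thesis
      by (subst (1 2) reinforced_step.simps) auto
  next
    case False
    then have "\<not> (l \<ge> 2 \<and> \<xi> l w' \<and> u l w' < l)" "g l w = g l w'"
      using assms less.prems by (auto simp: history_eq_iff)
    with False show ?thesis
      by (subst (1 2) reinforced_step.simps) auto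
  qed
qed

lemma process_events_Int:
  assumes "A \<in> process_events M N Y I" "B \<in> process_events M N Y I"
  shows "A \<inter> B \<in> process_events M N Y I"
proof -
  have "sigma_algebra (space M) (process_events M N Y I)"
    unfolding process_events_def by (rule sigma_algebra_sigma_sets) auto
  then interpret E: sigma_algebra "space M" "process_events M N Y I" .
  show ?thesis
    using assms by (rule E.Int)
qed

lemma process_events_subset_events:
  "process_events M (\<lambda>_. count_space UNIV) g {1..} \<subseteq> events"
  "process_events M (\<lambda>_. count_space UNIV) \<xi> {2..} \<subseteq> events"
  "process_events M (\<lambda>n. count_space {1..<n}) u {2..} \<subseteq> events"
proof -
  have *: "[process_events M (\<lambda>_. count_space UNIV) g {1..},
      process_events M (\<lambda>_. count_space UNIV) \<xi> {2..},
      process_events M (\<lambda>n. count_space {1..<n}) u {2..}] ! i \<subseteq> events" if "i < 3" for i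
    using sequences_indep that by (auto simp: indep_sets_def)
  from *[of 0] *[of 1] *[of 2] show
    "process_events M (\<lambda>_. count_space UNIV) g {1..} \<subseteq> events"
    "process_events M (\<lambda>_. count_space UNIV) \<xi> {2..} \<subseteq> events"
    "process_events M (\<lambda>n. count_space {1..<n}) u {2..} \<subseteq> events"
    by simp_all
qed

text \<open>A condition on the past and one on the present of the same sequence form together a cylinder of that
  sequence. Factoring first across the sequences, then within each one, and reassembling the past factors
  gives the product.\<close>

lemma history_cylinder_indep:
  assumes k: "k \<ge> 1" and U: "U \<subseteq> {1..k}" and w0: "w0 \<in> space M"
  shows "{w \<in> space M. history k w = history k w0} \<in> events"
    and "{w \<in> space M. g (Suc k) w \<in> G \<and> \<xi> (Suc k) w \<in> B \<and> u (Suc k) w \<in> U} \<in> events"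
    and "prob ({w \<in> space M. history k w = history k w0} \<inter>
           {w \<in> space M. g (Suc k) w \<in> G \<and> \<xi> (Suc k) w \<in> B \<and> u (Suc k) w \<in> U}) =
         prob {w \<in> space M. history k w = history k w0} *
           (prob {w \<in> space M. g (Suc k) w \<in> G} * prob {w \<in> space M. \<xi> (Suc k) w \<in> B} *
            prob {w \<in> space M. u (Suc k) w \<in> U})"
proof -
  define pg where "pg = {w \<in> space M. \<forall>j\<in>{1..k}. g j w \<in> {g j w0}}"
  define p\<xi> where "p\<xi> = {w \<in> space M. \<forall>j\<in>{2..k}. \<xi> j w \<in> {\<xi> j w0}}"
  define pu where "pu = {w \<in> space M. \<forall>j\<in>{2..k}. u j w \<in> {u j w0}}"
  define ng where "ng = {w \<in> space M. g (Suc k) w \<in> G}"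
  define n\<xi> where "n\<xi> = {w \<in> space M. \<xi> (Suc k) w \<in> B}"
  define nu where "nu = {w \<in> space M. u (Suc k) w \<in> U}"
  note u0 = u_range[OF _ w0]
  have past: "pg \<in> process_events M (\<lambda>_. count_space UNIV) g {1..}"
      "p\<xi> \<in> process_events M (\<lambda>_. count_space UNIV) \<xi> {2..}"
      "pu \<in> process_events M (\<lambda>n. count_space {1..<n}) u {2..}"
    unfolding pg_def p\<xi>_def pu_def using u0 by (intro cylinder_in_process_events; force)+
  have new: "ng \<in> process_events M (\<lambda>_. count_space UNIV) g {1..}"
      "n\<xi> \<in> process_events M (\<lambda>_. count_space UNIV) \<xi> {2..}"
      "nu \<in> process_events M (\<lambda>n. count_space {1..<n}) u {2..}"
    using cylinder_in_process_events[of "{Suc k}" "{1..}" "\<lambda>_. G" "\<lambda>_. count_space UNIV" M g]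
      cylinder_in_process_events[of "{Suc k}" "{2..}" "\<lambda>_. B" "\<lambda>_. count_space UNIV" M \<xi>]
      cylinder_in_process_events[of "{Suc k}" "{2..}" "\<lambda>_. U" "\<lambda>n. count_space {1..<n}" M u] k U
    by (auto simp: ng_def n\<xi>_def nu_def atLeastLessThanSuc_atLeastAtMost)
  have hist: "{w \<in> space M. history k w = history k w0} = pg \<inter> p\<xi> \<inter> pu"
    by (auto simp: history_eq_iff pg_def p\<xi>_def pu_def)
  have pres: "{w \<in> space M. g (Suc k) w \<in> G \<and> \<xi> (Suc k) w \<in> B \<and> u (Suc k) w \<in> U} = ng \<inter> n\<xi> \<inter> nu"
    by (auto simp: ng_def n\<xi>_def nu_def)
  show "{w \<in> space M. history k w = history k w0} \<in> events"
    unfolding hist using past process_events_subset_events by auto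
  show "{w \<in> space M. g (Suc k) w \<in> G \<and> \<xi> (Suc k) w \<in> B \<and> u (Suc k) w \<in> U} \<in> events"
    unfolding pres using new process_events_subset_events by auto
  have g: "prob (pg \<inter> ng) = prob pg * prob ng"
  proof -
    have "pg \<inter> ng = {w \<in> space M. (\<forall>j\<in>{1..k}. g j w \<in> {g j w0}) \<and> g (Suc k) w \<in> G}"
      unfolding pg_def ng_def by blast
    then show ?thesis
      unfolding pg_def ng_def by (simp only:) (rule indep_vars_split_off_one[OF g_indep]; simp)
  qed
  have \<xi>: "prob (p\<xi> \<inter> n\<xi>) = prob p\<xi> * prob n\<xi>"
  proof -
    have "p\<xi> \<inter> n\<xi> = {w \<in> space M. (\<forall>j\<in>{2..k}. \<xi> j w \<in> {\<xi> j w0}) \<and> \<xi> (Suc k) w \<in> B}"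
      unfolding p\<xi>_def n\<xi>_def by blast
    then show ?thesis
      unfolding p\<xi>_def n\<xi>_def using k by (simp only:) (rule indep_vars_split_off_one[OF \<xi>_indep]; simp)
  qed
  have u: "prob (pu \<inter> nu) = prob pu * prob nu"
  proof -
    have "pu \<inter> nu = {w \<in> space M. (\<forall>j\<in>{2..k}. u j w \<in> {u j w0}) \<and> u (Suc k) w \<in> U}"
      unfolding pu_def nu_def by blast
    moreover have "U \<in> sets (count_space {1..<Suc k})"
      using U by (auto simp: atLeastLessThanSuc_atLeastAtMost)
    ultimately show ?thesis
      unfolding pu_def nu_def using k u0
      by (simp only:) (rule indep_vars_split_off_one[OF u_indep]; force)
  qed
  have "prob ((pg \<inter> p\<xi> \<inter> pu) \<inter> (ng \<inter> n\<xi> \<inter> nu)) = prob ((pg \<inter> ng) \<inter> (p\<xi> \<inter> n\<xi>) \<inter> (pu \<inter> nu))"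
    by (simp add: Int_ac)
  also have "\<dots> = prob (pg \<inter> ng) * prob (p\<xi> \<inter> n\<xi>) * prob (pu \<inter> nu)"
    by (intro prob_three_sequences process_events_Int past new)
  also have "\<dots> = (prob pg * prob p\<xi> * prob pu) * (prob ng * prob n\<xi> * prob nu)"
    by (simp add: g \<xi> u)
  also have "prob pg * prob p\<xi> * prob pu = prob (pg \<inter> p\<xi> \<inter> pu)"
    by (intro prob_three_sequences[symmetric] past)
  finally show "prob ({w \<in> space M. history k w = history k w0} \<inter>
           {w \<in> space M. g (Suc k) w \<in> G \<and> \<xi> (Suc k) w \<in> B \<and> u (Suc k) w \<in> U}) =
         prob {w \<in> space M. history k w = history k w0} *
           (prob {w \<in> space M. g (Suc k) w \<in> G} * prob {w \<in> space M. \<xi> (Suc k) w \<in> B} *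
            prob {w \<in> space M. u (Suc k) w \<in> U})"
    unfolding hist pres by (simp add: ng_def n\<xi>_def nu_def)
qed

definition history_determined :: "nat \<Rightarrow> 'w set \<Rightarrow> bool" where
  "history_determined k E \<longleftrightarrow> E \<subseteq> space M \<and>
     (\<forall>w\<in>E. \<forall>w'\<in>space M. history k w = history k w' \<longrightarrow> w' \<in> E)"

lemma history_determined_eq_UN:
  assumes "history_determined k E"
  shows "E = (\<Union>h\<in>history k ` E. {w \<in> space M. history k w = h})"
proof (intro equalityI subsetI)
  fix w assume "w \<in> (\<Union>h\<in>history k ` E. {w \<in> space M. history k w = h})"
  then obtain w' where "w' \<in> E" "w \<in> space M" "history k w' = history k w"
    by auto
  then show "w \<in> E"
    using assms by (auto simp: history_determined_def)
qed (use assms in \<open>auto simp: history_determined_def\<close>)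

lemma finite_history_determined:
  assumes "history_determined k E"
  shows "finite (history k ` E)"
  using assms by (intro finite_subset[OF image_mono finite_history]) (simp add: history_determined_def)

lemma history_determined_event:
  assumes "k \<ge> 1" "history_determined k E"
  shows "E \<in> events"
proof -
  have "(\<Union>h\<in>history k ` E. {w \<in> space M. history k w = h}) \<in> events"
    using assms history_cylinder_indep(1)[OF assms(1), of "{}"] finite_history_determined[OF assms(2)]
    by (intro sets.finite_UN) (auto simp: history_determined_def)
  then show ?thesis
    by (subst history_determined_eq_UN[OF assms(2)])
qed

text \<open>The event is the disjoint union of the finitely many cylinders given by the histories of its points,
  and the product formula for cylinders adds up.\<close>

lemma history_determined_indep:
  assumes k: "k \<ge> 1" and U: "U \<subseteq> {1..k}" and E: "history_determined k E"
  shows "prob (E \<inter> {w \<in> space M. g (Suc k) w \<in> G \<and> \<xi> (Suc k) w \<in> B \<and> u (Suc k) w \<in> U}) =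
    prob E * (prob {w \<in> space M. g (Suc k) w \<in> G} * prob {w \<in> space M. \<xi> (Suc k) w \<in> B} *
            prob {w \<in> space M. u (Suc k) w \<in> U})" (is "prob (E \<inter> ?N) = prob E * ?p")
proof -
  let ?A = "\<lambda>h. {w \<in> space M. history k w = h}"
  have A: "?A h \<in> events" "?N \<in> events" "prob (?A h \<inter> ?N) = prob (?A h) * ?p" if "h \<in> history k ` E" for h
    using that E history_cylinder_indep[OF k U] by (auto simp: history_determined_def)
  note fin = finite_history_determined[OF E]
  have AN: "?A h \<inter> ?N \<in> events" if "h \<in> history k ` E" for h
    using A(1,2)[OF that] by (rule sets.Int)
  have "prob (E \<inter> ?N) = prob (\<Union>h\<in>history k ` E. ?A h \<inter> ?N)"
    by (subst history_determined_eq_UN[OF E], rule arg_cong[where f = prob]) auto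
  also have "\<dots> = (\<Sum>h\<in>history k ` E. prob (?A h \<inter> ?N))"
    using fin by (intro finite_measure_finite_Union image_subsetI AN) (auto simp: disjoint_family_on_def)
  also have "\<dots> = (\<Sum>h\<in>history k ` E. prob (?A h)) * ?p"
    using A by (simp add: sum_distrib_right)
  also have "(\<Sum>h\<in>history k ` E. prob (?A h)) = prob (\<Union>h\<in>history k ` E. ?A h)"
    using fin by (intro finite_measure_finite_Union[symmetric] image_subsetI A(1)) (auto simp: disjoint_family_on_def)
  also have "\<dots> = prob E"
    by (simp only: history_determined_eq_UN[OF E, symmetric])
  finally show ?thesis .
qed

section \<open>The conditional law of the next step\<close>

lemma reinforced_step_Suc:
  assumes "k \<ge> 1" "w \<in> space M"
  shows "reinforced_step g \<xi> u (Suc k) w =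
    (if \<xi> (Suc k) w then reinforced_step g \<xi> u (u (Suc k) w) w else g (Suc k) w)"
  using assms u_range[of "Suc k" w] by (subst reinforced_step.simps) auto

lemma history_determined_step:
  assumes l: "l \<in> {1..k}" and E: "history_determined k E"
  shows "history_determined k {w \<in> E. reinforced_step g \<xi> u l w = x}"
  unfolding history_determined_def
proof (intro conjI ballI impI)
  have E_space: "E \<subseteq> space M"
    using E by (simp add: history_determined_def)
  then show "{w \<in> E. reinforced_step g \<xi> u l w = x} \<subseteq> space M" by auto
  fix w w' assume w: "w \<in> {w \<in> E. reinforced_step g \<xi> u l w = x}" "w' \<in> space M" "history k w = history k w'"
  then have "w' \<in> E"
    using E by (auto simp: history_determined_def)
  moreover have "reinforced_step g \<xi> u l w' = reinforced_step g \<xi> u l w"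
    using w l E_space by (intro reinforced_step_history[symmetric, of l k]) auto
  ultimately show "w' \<in> {w \<in> E. reinforced_step g \<xi> u l w = x}" using w by simp
qed

lemma history_determined_mono:
  assumes "history_determined k E" "k \<le> m"
  shows "history_determined m E"
proof -
  have "history k w = history k w'" if "history m w = history m w'" for w w'
    using that \<open>k \<le> m\<close> by (simp add: history_eq_iff)
  then show ?thesis
    using assms(1) unfolding history_determined_def by blast
qed

text \<open>Split the event according to whether step \<open>k + 1\<close> is fresh or a copy of step \<open>l\<close>. In the latter case
  the condition on its value is a condition on step \<open>l\<close>, hence on the past, and so is independent of the
  choice of \<open>l\<close>.\<close>

lemma prob_next_step:
  assumes k: "k \<ge> 1" and E: "history_determined k E"
  shows "prob {w \<in> E. reinforced_step g \<xi> u (Suc k) w = x} =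
    (1 - \<alpha>) * pmf \<mu> x * prob E + \<alpha> / k * (\<Sum>l=1..k. prob {w \<in> E. reinforced_step g \<xi> u l w = x})"
proof -
  let ?X = "reinforced_step g \<xi> u"
  let ?N = "\<lambda>G B U. {w \<in> space M. g (Suc k) w \<in> G \<and> \<xi> (Suc k) w \<in> B \<and> u (Suc k) w \<in> U}"
  let ?F = "\<lambda>l. {w \<in> E. ?X l w = x}"
  have E_space: "E \<subseteq> space M"
    using E by (simp add: history_determined_def)
  have k2: "2 \<le> Suc k" using k by simp
  have F: "history_determined k (?F l)" if "l \<in> {1..k}" for l
    using that E by (rule history_determined_step)
  have U: "{w \<in> space M. u (Suc k) w \<in> {1..k}} = space M"
    using u_range[OF k2] unfolding atLeastLessThanSuc_atLeastAtMost by blast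
  have N: "?N G B V \<in> events" if "V \<subseteq> {1..k}" for G B V
  proof -
    obtain w0 where "w0 \<in> space M" using not_empty by auto
    then show ?thesis using history_cylinder_indep(2)[OF k that] by simp
  qed
  have "{w \<in> E. ?X (Suc k) w = x} = (E \<inter> ?N {x} {False} {1..k}) \<union> (\<Union>l\<in>{1..k}. ?F l \<inter> ?N UNIV {True} {l})"
    (is "_ = ?L \<union> ?R")
  proof (rule set_eqI)
    fix w
    show "w \<in> {w \<in> E. ?X (Suc k) w = x} \<longleftrightarrow> w \<in> ?L \<union> ?R"
    proof (cases "w \<in> E")
      case True
      then have "w \<in> space M" "u (Suc k) w \<in> {1..k}"
        using u_range[OF k2, of w] E_space by auto
      with True show ?thesis
        by (cases "\<xi> (Suc k) w") (simp_all add: reinforced_step_Suc[OF k])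
    qed simp
  qed
  moreover have L: "?L \<in> events"
    by (intro sets.Int history_determined_event[OF k E] N order_refl)
  moreover have R: "?F l \<inter> ?N UNIV {True} {l} \<in> events" if "l \<in> {1..k}" for l
    using that by (intro sets.Int history_determined_event[OF k] F N) auto
  ultimately have "prob {w \<in> E. ?X (Suc k) w = x} = prob (?L \<union> ?R)"
    by simp
  also have "\<dots> = prob ?L + prob ?R"
    using L R by (intro finite_measure_Union sets.finite_UN) auto
  also have "prob ?L = prob E * (pmf \<mu> x * (1 - \<alpha>))"
    using history_determined_indep[OF k order_refl E, of "{x}" "{False}"] prob_g[of "Suc k" x]
      prob_\<xi>[OF k2, of False] unfolding U by (simp add: prob_space)
  also have "prob ?R = (\<Sum>l=1..k. prob (?F l \<inter> ?N UNIV {True} {l}))"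
    using R by (intro finite_measure_finite_Union image_subsetI) (auto simp: disjoint_family_on_def)
  also have "\<dots> = (\<Sum>l=1..k. prob (?F l) * (\<alpha> / k))"
  proof (rule sum.cong)
    fix l assume l: "l \<in> {1..k}"
    then show "prob (?F l \<inter> ?N UNIV {True} {l}) = prob (?F l) * (\<alpha> / k)"
      using history_determined_indep[OF k _ F[OF l], of "{l}" UNIV "{True}"]
        prob_\<xi>[OF k2, of True] prob_u[OF k2, of l] by (simp add: prob_space)
  qed simp
  finally show ?thesis
    by (simp add: sum_distrib_left mult_ac)
qed

end

section \<open>The number of ones as a Markov chain\<close>

locale fair_bit_walk = finite_step_reinforced M \<alpha> \<mu> g \<xi> u
  for M :: "'w measure" and \<alpha> :: real and \<mu> :: "bit pmf" and g \<xi> u +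
  assumes fair: "pmf \<mu> x = 1 / 2"
begin

definition ones :: "nat \<Rightarrow> 'w \<Rightarrow> nat" where
  "ones k w = card {l \<in> {1..k}. reinforced_step g \<xi> u l w = 1}"

definition ones_prob :: "nat \<Rightarrow> nat \<Rightarrow> real" where
  "ones_prob k i = prob {w \<in> space M. ones k w = i}"

text \<open>The transition probability of the count from \<open>i\<close> to \<open>i + 1\<close> at time \<open>k\<close>.\<close>

definition next_one_prob :: "nat \<Rightarrow> nat \<Rightarrow> real" where
  "next_one_prob k i = (1 - \<alpha>) / 2 + \<alpha> * i / k"

text \<open>The function \<open>H\<^sub>k\<close> of the introduction: the moment generating function of \<open>k - 2 * K\<^sub>k\<close> under the
  signed weight \<open>(-1)^K\<^sub>k\<close>.\<close>

definition sign_mgf :: "nat \<Rightarrow> real \<Rightarrow> real" where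
  "sign_mgf k x = (\<Sum>i\<le>k. ones_prob k i * ((-1) ^ i * exp (x * (real k - 2 * real i))))"

lemma ones_Suc:
  "ones (Suc k) w = (if reinforced_step g \<xi> u (Suc k) w = 1 then Suc (ones k w) else ones k w)"
proof -
  let ?A = "{l \<in> {1..k}. reinforced_step g \<xi> u l w = 1}"
  have "{l \<in> {1..Suc k}. reinforced_step g \<xi> u l w = 1} =
      (if reinforced_step g \<xi> u (Suc k) w = 1 then insert (Suc k) ?A else ?A)"
    by (auto simp: le_Suc_eq)
  moreover have "Suc k \<notin> ?A" "finite ?A" by auto
  ultimately show ?thesis by (simp add: ones_def)
qed

lemma ones_le: "ones k w \<le> k"
proof -
  have "ones k w \<le> card {1..k}"
    unfolding ones_def by (rule card_mono) auto
  then show ?thesis by simp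
qed

lemma reinforced_walk_eq_0_iff: "reinforced_walk g \<xi> u k w = 0 \<longleftrightarrow> even (ones k w)"
proof (induction k)
  case 0
  then show ?case by (simp add: reinforced_walk_def ones_def)
next
  case (Suc k)
  have "reinforced_walk g \<xi> u (Suc k) w = reinforced_walk g \<xi> u k w + reinforced_step g \<xi> u (Suc k) w"
    by (simp add: reinforced_walk_def)
  with Suc show ?case
    by (cases "reinforced_step g \<xi> u (Suc k) w"; cases "reinforced_walk g \<xi> u k w") (auto simp: ones_Suc)
qed

lemma history_determined_ones: "history_determined k {w \<in> space M. ones k w = i}"
proof -
  have "ones k w = ones k w'" if "w \<in> space M" "w' \<in> space M" "history k w = history k w'" for w w'
  proof -
    have "{l \<in> {1..k}. reinforced_step g \<xi> u l w = 1} = {l \<in> {1..k}. reinforced_step g \<xi> u l w' = 1}"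
      using reinforced_step_history[OF _ _ that] by auto
    then show ?thesis by (simp add: ones_def)
  qed
  note same = this
  show ?thesis
    unfolding history_determined_def
  proof (intro conjI ballI impI)
    fix w w' assume "w \<in> {w \<in> space M. ones k w = i}" "w' \<in> space M" "history k w = history k w'"
    with same[of w w'] show "w' \<in> {w \<in> space M. ones k w = i}"
      by simp
  qed auto
qed

lemma ones_event: "k \<ge> 1 \<Longrightarrow> {w \<in> space M. ones k w = i} \<in> events"
  using history_determined_event history_determined_ones by blast

lemma ones_next_event:
  "{w \<in> {w \<in> space M. ones k w = i}. reinforced_step g \<xi> u (Suc k) w = 1} \<in> events"
  by (intro history_determined_event[of "Suc k"] history_determined_step
      history_determined_mono[OF history_determined_ones]) auto

text \<open>On the event that \<open>i\<close> of the first \<open>k\<close> steps are ones, summing over the copied step counts every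
  outcome \<open>i\<close> times. So the count alone determines the conditional probability.\<close>

lemma prob_next_one:
  assumes k: "k \<ge> 1"
  shows "prob {w \<in> {w \<in> space M. ones k w = i}. reinforced_step g \<xi> u (Suc k) w = 1} =
    next_one_prob k i * ones_prob k i"
proof -
  let ?E = "{w \<in> space M. ones k w = i}"
  let ?F = "\<lambda>l. {w \<in> ?E. reinforced_step g \<xi> u l w = 1}"
  have F: "?F l \<in> events" if "l \<in> {1..k}" for l
    using that by (intro history_determined_event[OF k] history_determined_step history_determined_ones)
  have count: "(\<Sum>l=1..k. indicator (?F l) w) = real i * indicator ?E w" for w
  proof (cases "w \<in> ?E")
    case True
    then have "(\<Sum>l=1..k. indicator (?F l) w) =
        (\<Sum>l=1..k. if reinforced_step g \<xi> u l w = 1 then 1 else 0 :: real)"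
      by (intro sum.cong) (auto simp: indicator_def)
    also have "\<dots> = real (ones k w)"
      by (simp add: ones_def sum.If_cases Int_def)
    finally show ?thesis using True by simp
  qed (auto simp: indicator_def)
  have "(\<Sum>l=1..k. prob (?F l)) = (\<Sum>l=1..k. expectation (indicator (?F l)))"
    using F by (intro sum.cong) (auto simp: sets.sets_into_space Int_absorb2)
  also have "\<dots> = expectation (\<lambda>w. \<Sum>l=1..k. indicator (?F l) w)"
    using F by (intro Bochner_Integration.integral_sum[symmetric]) (auto simp: less_top[symmetric])
  also have "\<dots> = real i * prob ?E"
    unfolding count by (simp add: Int_absorb2 sets.sets_into_space[OF ones_event[OF k]])
  finally have "(\<Sum>l=1..k. prob (?F l)) = real i * prob ?E" .
  then show ?thesis
    using prob_next_step[OF k history_determined_ones, of i 1]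
    by (simp add: fair next_one_prob_def ones_prob_def field_simps)
qed

lemma ones_prob_Suc:
  assumes k: "k \<ge> 1"
  shows "ones_prob (Suc k) i = (1 - next_one_prob k i) * ones_prob k i +
    (if i = 0 then 0 else next_one_prob k (i - 1) * ones_prob k (i - 1))"
proof -
  let ?E = "\<lambda>i. {w \<in> space M. ones k w = i}"
  let ?F = "\<lambda>i. {w \<in> ?E i. reinforced_step g \<xi> u (Suc k) w = 1}"
  let ?P = "if i = 0 then {} else ?F (i - 1)"
  have "{w \<in> space M. ones (Suc k) w = i} = (?E i - ?F i) \<union> ?P"
    by (auto simp: ones_Suc split: if_splits)
  then have "ones_prob (Suc k) i = prob ((?E i - ?F i) \<union> ?P)"
    by (simp only: ones_prob_def)
  also have "\<dots> = prob (?E i - ?F i) + prob ?P"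
    using ones_event[OF k, of i] ones_next_event[of k]
    by (intro finite_measure_Union sets.Diff) auto
  also have "prob (?E i - ?F i) = prob (?E i) - prob (?F i)"
    using ones_event[OF k, of i] ones_next_event[of k i] by (intro finite_measure_Diff) auto
  finally show ?thesis
    using prob_next_one[OF k] by (simp add: ones_prob_def algebra_simps)
qed

lemma ones_prob_eq_0: "k < i \<Longrightarrow> ones_prob k i = 0"
proof -
  assume "k < i"
  then have "{w \<in> space M. ones k w = i} = {}" using ones_le[of k] by (auto simp: not_le[symmetric])
  then show ?thesis by (simp only: ones_prob_def measure_empty)
qed

lemma sum_ones_prob_Suc:
  assumes k: "k \<ge> 1"
  shows "(\<Sum>i\<le>Suc k. ones_prob (Suc k) i * f i) =
    (\<Sum>i\<le>k. ones_prob k i * ((1 - next_one_prob k i) * f i + next_one_prob k i * f (Suc i)))"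
proof -
  let ?r = "next_one_prob k" and ?p = "ones_prob k"
  have "(\<Sum>i\<le>Suc k. ones_prob (Suc k) i * f i) =
      (\<Sum>i\<le>Suc k. (1 - ?r i) * ?p i * f i) +
      (\<Sum>i\<le>Suc k. (if i = 0 then 0 else ?r (i - 1) * ?p (i - 1)) * f i)"
    unfolding ones_prob_Suc[OF k] distrib_right sum.distrib ..
  also have "(\<Sum>i\<le>Suc k. (1 - ?r i) * ?p i * f i) = (\<Sum>i\<le>k. (1 - ?r i) * ?p i * f i)"
    by (simp add: ones_prob_eq_0)
  also have "(\<Sum>i\<le>Suc k. (if i = 0 then 0 else ?r (i - 1) * ?p (i - 1)) * f i) =
      (\<Sum>i\<le>k. ?r i * ?p i * f (Suc i))"
    by (subst sum.atMost_Suc_shift) simp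
  finally show ?thesis
    by (simp add: sum.distrib[symmetric] algebra_simps)
qed

lemma sign_mgf_1: "sign_mgf 1 x = sinh x"
proof -
  have X1: "reinforced_step g \<xi> u 1 w = g 1 w" for w
    by (subst reinforced_step.simps) simp
  have "ones 1 w = (if g 1 w = 1 then 1 else 0)" for w
    using ones_Suc[of 0 w] X1[of w] by (simp add: ones_def)
  then have "{w \<in> space M. ones 1 w = 0} = {w \<in> space M. g 1 w = 0}"
      "{w \<in> space M. ones 1 w = 1} = {w \<in> space M. g 1 w = 1}"
    by (auto split: if_splits)
  then have "ones_prob 1 0 = 1 / 2" "ones_prob 1 1 = 1 / 2"
    using prob_g[of 1] fair by (simp_all add: ones_prob_def)
  then show ?thesis
    by (simp add: sign_mgf_def sinh_field_def field_simps)
qed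

text \<open>The displacement \<open>k - 2 * i\<close> in the drift of the chain is what differentiation of
  \<open>exp (x * (k - 2 * i))\<close> produces; the sum on the right is the derivative of \<open>sign_mgf k\<close>.\<close>

lemma sign_mgf_Suc:
  assumes k: "k \<ge> 1"
  shows "sign_mgf (Suc k) x = sinh x * sign_mgf k x + \<alpha> / k * (cosh x *
    (\<Sum>i\<le>k. ones_prob k i * ((-1) ^ i * (exp (x * (real k - 2 * real i)) * (real k - 2 * real i)))))"
proof -
  let ?e = "\<lambda>i. exp (x * (real k - 2 * real i))"
  have "sign_mgf (Suc k) x = (\<Sum>i\<le>k. ones_prob k i *
     ((1 - next_one_prob k i) * ((-1) ^ i * exp (x * (real (Suc k) - 2 * real i))) +
      next_one_prob k i * ((-1) ^ Suc i * exp (x * (real (Suc k) - 2 * real (Suc i))))))"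
    unfolding sign_mgf_def by (rule sum_ones_prob_Suc[OF k])
  also have "\<dots> = (\<Sum>i\<le>k. ones_prob k i *
      (sinh x * ((-1) ^ i * ?e i) + \<alpha> / k * (cosh x * ((-1) ^ i * (?e i * (real k - 2 * real i))))))"
  proof (intro sum.cong refl arg_cong2[where f = "(*)"])
    fix i
    have e1: "exp (x * (real (Suc k) - 2 * real i)) = exp x * ?e i"
      by (simp add: exp_add[symmetric] algebra_simps)
    have e2: "exp (x * (real (Suc k) - 2 * real (Suc i))) = exp (- x) * ?e i"
      by (simp add: exp_add[symmetric] algebra_simps)
    have r: "exp x * (1 - next_one_prob k i) - exp (- x) * next_one_prob k i =
        sinh x + \<alpha> / k * cosh x * (real k - 2 * real i)"
      using k by (simp add: next_one_prob_def sinh_field_def cosh_field_def field_simps)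
    have "(1 - next_one_prob k i) * ((-1) ^ i * (exp x * ?e i)) +
        next_one_prob k i * ((-1) ^ Suc i * (exp (- x) * ?e i)) =
        (exp x * (1 - next_one_prob k i) - exp (- x) * next_one_prob k i) * ((-1) ^ i * ?e i)"
      by (simp add: algebra_simps)
    also have "\<dots> = sinh x * ((-1) ^ i * ?e i) + \<alpha> / k * (cosh x * ((-1) ^ i * (?e i * (real k - 2 * real i))))"
      unfolding r by (simp add: algebra_simps)
    finally show "(1 - next_one_prob k i) * ((-1) ^ i * exp (x * (real (Suc k) - 2 * real i))) +
        next_one_prob k i * ((-1) ^ Suc i * exp (x * (real (Suc k) - 2 * real (Suc i)))) =
        sinh x * ((-1) ^ i * ?e i) + \<alpha> / k * (cosh x * ((-1) ^ i * (?e i * (real k - 2 * real i))))"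
      unfolding e1 e2 .
  qed
  also have "\<dots> = sinh x * sign_mgf k x + \<alpha> / k * (cosh x *
      (\<Sum>i\<le>k. ones_prob k i * ((-1) ^ i * (?e i * (real k - 2 * real i)))))"
    unfolding sign_mgf_def sum_distrib_left sum.distrib[symmetric]
    by (intro sum.cong refl) (simp only: distrib_left mult_ac)
  finally show ?thesis .
qed

lemma sign_mgf_eq_fourier_poly:
  assumes "k \<ge> 1"
  shows "sign_mgf k x = poly (fourier_poly \<alpha> k) (sinh x)"
  using sign_mgf_1 sign_mgf_Suc _ assms
proof (rule poly_fourier_poly_sinh)
  fix k x
  show "(sign_mgf k has_real_derivative
      (\<Sum>i\<le>k. ones_prob k i * ((-1) ^ i * (exp (x * (real k - 2 * real i)) * (real k - 2 * real i))))) (at x)"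
    unfolding sign_mgf_def by (rule DERIV_sum) (auto intro!: derivative_eq_intros)
qed auto

lemma two_prob_walk_0_minus_1:
  assumes k: "k \<ge> 1"
  shows "2 * \<P>(w in M. reinforced_walk g \<xi> u k w = 0) - 1 = poly (fourier_poly \<alpha> k) 0"
proof -
  let ?E = "\<lambda>i. {w \<in> space M. ones k w = i}"
  have union: "prob (\<Union>i\<in>I. ?E i) = (\<Sum>i\<in>I. ones_prob k i)" if "finite I" for I
    unfolding ones_prob_def using that ones_event[OF k]
    by (intro finite_measure_finite_Union) (auto simp: disjoint_family_on_def)
  have "{w \<in> space M. reinforced_walk g \<xi> u k w = 0} = (\<Union>i\<in>{i. i \<le> k \<and> even i}. ?E i)"
    using ones_le by (auto simp: reinforced_walk_eq_0_iff)
  then have walk: "\<P>(w in M. reinforced_walk g \<xi> u k w = 0) = (\<Sum>i | i \<le> k \<and> even i. ones_prob k i)"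
    by (simp add: union)
  have "(\<Union>i\<in>{..k}. ?E i) = space M"
    using ones_le by auto
  then have total: "(\<Sum>i\<le>k. ones_prob k i) = 1"
    using union[of "{..k}"] by (simp add: prob_space)
  have "(\<Sum>i | i \<le> k \<and> even i. ones_prob k i) = (\<Sum>i\<le>k. if even i then ones_prob k i else 0)"
    by (simp add: sum.inter_filter[symmetric])
  then have "2 * \<P>(w in M. reinforced_walk g \<xi> u k w = 0) - 1 =
      (\<Sum>i\<le>k. 2 * (if even i then ones_prob k i else 0) - ones_prob k i)"
    by (simp add: walk total sum_subtractf sum_distrib_left)
  also have "\<dots> = (\<Sum>i\<le>k. ones_prob k i * (-1) ^ i)"
    by (intro sum.cong) auto
  also have "\<dots> = poly (fourier_poly \<alpha> k) (sinh 0)"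
    unfolding sign_mgf_eq_fourier_poly[OF k, symmetric] by (simp add: sign_mgf_def)
  finally show ?thesis by simp
qed

end

section \<open>Limits at the end points\<close>

lemma ln_ratio_tendsto_at_right_0:
  fixes a :: "real \<Rightarrow> real"
  assumes lower: "\<And>\<alpha>. 0 < \<alpha> \<Longrightarrow> \<alpha> < 1 \<Longrightarrow> exp (- ((1 - \<alpha>) * real n)) * \<alpha> ^ n \<le> a \<alpha>"
    and upper: "\<And>\<alpha>. 0 < \<alpha> \<Longrightarrow> \<alpha> < 1 \<Longrightarrow> a \<alpha> \<le> \<alpha> ^ n"
  shows "((\<lambda>\<alpha>. ln (a \<alpha>) / ln \<alpha>) \<longlongrightarrow> real n) (at_right 0)"
proof (rule tendsto_sandwich)
  have near: "eventually (\<lambda>\<alpha>::real. 0 < \<alpha> \<and> \<alpha> < 1) (at_right 0)"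
    using eventually_at_right_real[of 0 1] by simp
  have bounds: "real n \<le> ln (a \<alpha>) / ln \<alpha> \<and> ln (a \<alpha>) / ln \<alpha> \<le> real n - (1 - \<alpha>) * real n / ln \<alpha>"
    if \<alpha>: "0 < \<alpha> \<and> \<alpha> < 1" for \<alpha>
  proof -
    have pos: "0 < exp (- ((1 - \<alpha>) * real n)) * \<alpha> ^ n" using \<alpha> by simp
    moreover from this have a_pos: "0 < a \<alpha>"
      using lower[of \<alpha>] \<alpha> by linarith
    ultimately have "ln (exp (- ((1 - \<alpha>) * real n)) * \<alpha> ^ n) \<le> ln (a \<alpha>)"
      using lower \<alpha> by (subst ln_le_cancel_iff) auto
    then have "real n * ln \<alpha> - (1 - \<alpha>) * real n \<le> ln (a \<alpha>)"
      using \<alpha> by (simp add: ln_mult ln_realpow)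
    moreover have "ln (a \<alpha>) \<le> ln (\<alpha> ^ n)"
      using upper[of \<alpha>] a_pos \<alpha> by (subst ln_le_cancel_iff) auto
    then have "ln (a \<alpha>) \<le> real n * ln \<alpha>"
      using \<alpha> by (simp add: ln_realpow)
    moreover have "ln \<alpha> < 0" using \<alpha> by simp
    ultimately show ?thesis by (simp add: field_simps)
  qed
  show "eventually (\<lambda>\<alpha>. real n \<le> ln (a \<alpha>) / ln \<alpha>) (at_right 0)"
    using near by eventually_elim (use bounds in blast)
  show "eventually (\<lambda>\<alpha>. ln (a \<alpha>) / ln \<alpha> \<le> real n - (1 - \<alpha>) * real n / ln \<alpha>) (at_right 0)"
    using near by eventually_elim (use bounds in blast)
  show "((\<lambda>\<alpha>. real n - (1 - \<alpha>) * real n / ln \<alpha>) \<longlongrightarrow> real n) (at_right 0)"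
    by real_asymp
qed simp

text \<open>The quantity \<open>(1 - a \<alpha>) / 2\<close> is of order \<open>1 - \<alpha>\<close>: the upper bound on \<open>a\<close> and \<open>\<alpha>^n \<le> \<alpha>\<close> make it at
  least \<open>(1 - \<alpha>) / 2\<close>, while the lower bound, \<open>exp (- (1 - \<alpha>)) \<ge> \<alpha>\<close> and Bernoulli's inequality make it at
  most \<open>n * (1 - \<alpha>)\<close>. Constant factors disappear after division by \<open>ln (1 - \<alpha>)\<close>.\<close>

lemma ln_ratio_tendsto_at_left_1:
  fixes a :: "real \<Rightarrow> real"
  assumes n: "n \<ge> 1"
    and lower: "\<And>\<alpha>. 0 < \<alpha> \<Longrightarrow> \<alpha> < 1 \<Longrightarrow> exp (- ((1 - \<alpha>) * real n)) * \<alpha> ^ n \<le> a \<alpha>"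
    and upper: "\<And>\<alpha>. 0 < \<alpha> \<Longrightarrow> \<alpha> < 1 \<Longrightarrow> a \<alpha> \<le> \<alpha> ^ n"
  shows "((\<lambda>\<alpha>. ln ((1 - a \<alpha>) / 2) / ln (1 - \<alpha>)) \<longlongrightarrow> 1) (at_left 1)"
proof (rule tendsto_sandwich)
  have near: "eventually (\<lambda>\<alpha>::real. 0 < \<alpha> \<and> \<alpha> < 1) (at_left 1)"
    using eventually_at_left_real[of 0 1] by simp
  have bounds: "1 + ln (real n) / ln (1 - \<alpha>) \<le> ln ((1 - a \<alpha>) / 2) / ln (1 - \<alpha>) \<and>
      ln ((1 - a \<alpha>) / 2) / ln (1 - \<alpha>) \<le> 1 - ln 2 / ln (1 - \<alpha>)"
    if \<alpha>: "0 < \<alpha> \<and> \<alpha> < 1" for \<alpha>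
  proof -
    have "\<alpha> ^ n \<le> \<alpha>"
      using \<alpha> n power_decreasing[of 1 n \<alpha>] by simp
    then have lo: "(1 - \<alpha>) / 2 \<le> (1 - a \<alpha>) / 2"
      using upper[of \<alpha>] \<alpha> by simp
    have "\<alpha> \<le> exp (- (1 - \<alpha>))"
      using exp_ge_add_one_self[of "- (1 - \<alpha>)"] by simp
    then have "\<alpha> ^ n \<le> exp (- (1 - \<alpha>)) ^ n"
      using \<alpha> by (intro power_mono) auto
    also have "\<dots> = exp (- ((1 - \<alpha>) * real n))"
      by (simp add: exp_of_nat_mult[symmetric] algebra_simps)
    finally have "\<alpha> ^ n * \<alpha> ^ n \<le> exp (- ((1 - \<alpha>) * real n)) * \<alpha> ^ n"
      using \<alpha> by (intro mult_right_mono) auto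
    then have "\<alpha> ^ (2 * n) \<le> a \<alpha>"
      unfolding mult_2 power_add using lower[of \<alpha>] \<alpha> by linarith
    moreover have "1 + real (2 * n) * (\<alpha> - 1) \<le> (1 + (\<alpha> - 1)) ^ (2 * n)"
      using \<alpha> by (intro Bernoulli_inequality) auto
    ultimately have "1 + real (2 * n) * (\<alpha> - 1) \<le> a \<alpha>"
      by simp
    then have hi: "(1 - a \<alpha>) / 2 \<le> real n * (1 - \<alpha>)"
      by (simp add: field_simps)
    define L where "L = ln ((1 - a \<alpha>) / 2)"
    have "ln ((1 - \<alpha>) / 2) \<le> L"
      unfolding L_def using lo \<alpha> by (subst ln_le_cancel_iff) auto
    then have "ln (1 - \<alpha>) - ln 2 \<le> L"
      using \<alpha> by (simp add: ln_div)
    moreover have "L \<le> ln (real n * (1 - \<alpha>))"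
      unfolding L_def using lo hi \<alpha> n by (subst ln_le_cancel_iff) auto
    then have "L \<le> ln (real n) + ln (1 - \<alpha>)"
      using \<alpha> n by (simp add: ln_mult)
    moreover have neg: "ln (1 - \<alpha>) < 0"
      using \<alpha> by simp
    ultimately have "(ln (real n) + ln (1 - \<alpha>)) / ln (1 - \<alpha>) \<le> L / ln (1 - \<alpha>)"
        "L / ln (1 - \<alpha>) \<le> (ln (1 - \<alpha>) - ln 2) / ln (1 - \<alpha>)"
      by (auto intro: divide_right_mono_neg)
    then show ?thesis
      unfolding L_def[symmetric] using neg by (simp add: add_divide_distrib diff_divide_distrib)
  qed
  show "eventually (\<lambda>\<alpha>. 1 + ln (real n) / ln (1 - \<alpha>) \<le> ln ((1 - a \<alpha>) / 2) / ln (1 - \<alpha>)) (at_left 1)"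
    using near by eventually_elim (use bounds in blast)
  show "eventually (\<lambda>\<alpha>. ln ((1 - a \<alpha>) / 2) / ln (1 - \<alpha>) \<le> 1 - ln 2 / ln (1 - \<alpha>)) (at_left 1)"
    using near by eventually_elim (use bounds in blast)
  show "((\<lambda>\<alpha>. 1 + ln (real n) / ln (1 - \<alpha>)) \<longlongrightarrow> 1) (at_left 1)"
    by real_asymp
  show "((\<lambda>\<alpha>. 1 - ln 2 / ln (1 - \<alpha>)) \<longlongrightarrow> (1::real)) (at_left 1)"
    by real_asymp
qed

section \<open>Return probabilities of the walk\<close>

theorem corollary1p6:
  fixes \<mu> :: "bit pmf" and n :: nat
  assumes "pmf \<mu> 0 = 1/2" and "pmf \<mu> 1 = 1/2" and "n \<ge> 1"
  shows
   "(\<forall>(\<alpha>::real) (M::'w measure) g \<xi> u.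
       0 < \<alpha> \<and> \<alpha> < 1 \<and> step_reinforced M \<alpha> \<mu> g \<xi> u \<longrightarrow>
         \<P>(w in M. reinforced_walk g \<xi> u (2*n-1) w = 0) = 1/2 \<and>
         exp (- ((1 - \<alpha>) * real n)) * \<alpha> ^ n
           \<le> 2 * \<P>(w in M. reinforced_walk g \<xi> u (2*n) w = 0) - 1 \<and>
         2 * \<P>(w in M. reinforced_walk g \<xi> u (2*n) w = 0) - 1 \<le> \<alpha> ^ n) \<and>
    (\<forall>(M::real \<Rightarrow> 'w measure) g \<xi> u.
       (\<forall>\<alpha>. 0 < \<alpha> \<and> \<alpha> < 1 \<longrightarrow> step_reinforced (M \<alpha>) \<alpha> \<mu> (g \<alpha>) (\<xi> \<alpha>) (u \<alpha>)) \<longrightarrow>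
         ((\<lambda>\<alpha>. ln (2 * \<P>(w in M \<alpha>. reinforced_walk (g \<alpha>) (\<xi> \<alpha>) (u \<alpha>) (2*n) w = 0) - 1) / ln \<alpha>)
            \<longlongrightarrow> real n) (at_right 0) \<and>
         ((\<lambda>\<alpha>. ln (1 - \<P>(w in M \<alpha>. reinforced_walk (g \<alpha>) (\<xi> \<alpha>) (u \<alpha>) (2*n) w = 0)) / ln (1 - \<alpha>))
            \<longlongrightarrow> 1) (at_left 1))"
proof (intro conjI allI impI; (elim conjE)?)
  have fair: "fair_bit_walk M \<alpha> \<mu> g \<xi> u" if "step_reinforced M \<alpha> \<mu> g \<xi> u"
    for M :: "'w measure" and \<alpha> g \<xi> u
  proof -
    interpret step_reinforced M \<alpha> \<mu> g \<xi> u by (fact that)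
    show ?thesis
    proof
      have "(UNIV :: bit set) = {0, 1}"
        by (auto intro: bit.exhaust)
      moreover have "finite {0, 1 :: bit}" by simp
      ultimately show "finite (UNIV :: bit set)" by (simp only:)
      show "pmf \<mu> x = 1 / 2" for x
        using assms by (cases x) auto
    qed
  qed
  have odd: "\<P>(w in M. reinforced_walk g \<xi> u (2*n-1) w = 0) = 1/2"
    and lower: "exp (- ((1 - \<alpha>) * real n)) * \<alpha> ^ n \<le> 2 * \<P>(w in M. reinforced_walk g \<xi> u (2*n) w = 0) - 1"
    and upper: "2 * \<P>(w in M. reinforced_walk g \<xi> u (2*n) w = 0) - 1 \<le> \<alpha> ^ n"
    if "step_reinforced M \<alpha> \<mu> g \<xi> u" for M :: "'w measure" and \<alpha> g \<xi> u
  proof -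
    interpret fair_bit_walk M \<alpha> \<mu> g \<xi> u by (rule fair[OF that])
    show "\<P>(w in M. reinforced_walk g \<xi> u (2*n-1) w = 0) = 1/2"
    proof -
      have "2 * n - 1 \<ge> 1" "odd (2 * n - 1)" using \<open>n \<ge> 1\<close> by auto
      then show ?thesis
        using two_prob_walk_0_minus_1[of "2 * n - 1"] fourier_poly_odd_at_0[of "2 * n - 1" \<alpha>] by linarith
    qed
    show "exp (- ((1 - \<alpha>) * real n)) * \<alpha> ^ n \<le> 2 * \<P>(w in M. reinforced_walk g \<xi> u (2*n) w = 0) - 1"
      "2 * \<P>(w in M. reinforced_walk g \<xi> u (2*n) w = 0) - 1 \<le> \<alpha> ^ n"
      using two_prob_walk_0_minus_1[of "2 * n"] fourier_poly_even_at_0[OF param \<open>n \<ge> 1\<close>] \<open>n \<ge> 1\<close>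
      by simp_all
  qed
  {
    fix \<alpha> :: real and M :: "'w measure" and g \<xi> u
    assume "step_reinforced M \<alpha> \<mu> g \<xi> u"
    then show "\<P>(w in M. reinforced_walk g \<xi> u (2*n-1) w = 0) = 1/2"
      and "exp (- ((1 - \<alpha>) * real n)) * \<alpha> ^ n \<le> 2 * \<P>(w in M. reinforced_walk g \<xi> u (2*n) w = 0) - 1"
      and "2 * \<P>(w in M. reinforced_walk g \<xi> u (2*n) w = 0) - 1 \<le> \<alpha> ^ n"
      by (fact odd, fact lower, fact upper)
  next
    fix M :: "real \<Rightarrow> 'w measure" and g \<xi> u
    assume walks: "\<forall>\<alpha>. 0 < \<alpha> \<and> \<alpha> < 1 \<longrightarrow> step_reinforced (M \<alpha>) \<alpha> \<mu> (g \<alpha>) (\<xi> \<alpha>) (u \<alpha>)"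
    define a where "a \<alpha> = 2 * \<P>(w in M \<alpha>. reinforced_walk (g \<alpha>) (\<xi> \<alpha>) (u \<alpha>) (2*n) w = 0) - 1" for \<alpha>
    have a: "exp (- ((1 - \<alpha>) * real n)) * \<alpha> ^ n \<le> a \<alpha>" "a \<alpha> \<le> \<alpha> ^ n" if "0 < \<alpha>" "\<alpha> < 1" for \<alpha>
      unfolding a_def using walks that by (auto intro!: lower upper)
    show "((\<lambda>\<alpha>. ln (2 * \<P>(w in M \<alpha>. reinforced_walk (g \<alpha>) (\<xi> \<alpha>) (u \<alpha>) (2*n) w = 0) - 1) / ln \<alpha>)
        \<longlongrightarrow> real n) (at_right 0)"
      using ln_ratio_tendsto_at_right_0[OF a] by (simp add: a_def)
    have "(1 - a \<alpha>) / 2 = 1 - \<P>(w in M \<alpha>. reinforced_walk (g \<alpha>) (\<xi> \<alpha>) (u \<alpha>) (2*n) w = 0)" for \<alpha>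
      by (simp add: a_def field_simps)
    then show "((\<lambda>\<alpha>. ln (1 - \<P>(w in M \<alpha>. reinforced_walk (g \<alpha>) (\<xi> \<alpha>) (u \<alpha>) (2*n) w = 0)) / ln (1 - \<alpha>))
        \<longlongrightarrow> 1) (at_left 1)"
      using ln_ratio_tendsto_at_left_1[OF \<open>n \<ge> 1\<close> a] by (simp only:)
  }
qed

end
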